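(* Let $\Gamma$ be any graph in the family $\mathcal{F}_n$, with $n'$ vertices in total, and let $\mathcal{A},\mathcal{B}$ be as in the construction of $\mathcal{F}_n$. Then $(\lambda,\mathbf{v},\mathbf{u})$ is a Jordan chain for $K(\Gamma)$, where $\lambda=-2$ and $\mathbf{v},\mathbf{u}\in\mathbb{C}^{2n'}$ are given, for each vertex $j$ of $\Gamma$, by $$\mathbf{v}_j=\begin{cases}1& j\in\mathcal{A}\\ -1& j\in\mathcal{B}\\ 0&\text{else}\end{cases}\quad \mathbf{v}_{n'+j}=\begin{cases}1/2& j\in\mathcal{A}\\ -1/2& j\in\mathcal{B}\\ 0&\text{else}\end{cases}\quad \mathbf{u}_j=\begin{cases}-1/2& j\in\mathcal{A}\\ 1/2& j\in\mathcal{B}\\ 0&\text{else}\end{cases}\quad \mathbf{u}_{n'+j}=0.$$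
   Context: For a simple graph $\Gamma$ on vertices $1,\dots,n'$ with adjacency matrix $A$ and diagonal degree matrix $D$, $K(\Gamma)=\begin{bmatrix} A & D-I_{n'}\\ -I_{n'} & 0\end{bmatrix}$, a $2n'\times 2n'$ matrix. "$(\lambda,\mathbf{v},\mathbf{u})$ is a Jordan chain for $K$" means $\mathbf{v}\neq0$, $K\mathbf{v}=\lambda\mathbf{v}$ and $K\mathbf{u}=\lambda\mathbf{u}+\mathbf{v}$. The family $\mathcal{F}_n$ consists of the graphs built as follows. (1) Start with a $4$-regular bipartite graph $G$ on $2n$ vertices with partite sets $\mathcal{A}=\{a_1,\dots,a_n\}$ and $\mathcal{B}=\{b_1,\dots,b_n\}$. (2) Let $H$ be a simple graph on $\ell\ge1$ vertices and take the disjoint union $G\cup H$. (3) For each $1\le i\le n$, add exactly one edge from $a_i$ to some single vertex of $H$ and exactly one edge from $b_i$ to some single vertex of $H$, in such a way that each vertex $h$ of $H$ is adjacent to the same number of vertices in $\mathcal{A}$ as in $\mathcal{B}$ (i.e. $|N(h)\cap\mathcal{A}|=|N(h)\cap\mathcal{B}|$ for each $h$), and such that the resulting graph is connected. *)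

theory Defs
  imports
    Complex_Main
    "Graph_Theory.Digraph_Component"
    "Jordan_Normal_Form.Char_Poly"
begin

text \<open>
  Simple graphs are rendered by the locale \<^locale>\<open>pair_graph\<close>: finite, loop-free, symmetric digraphs
  without parallel arcs. An undirected edge between x and y is the pair of arcs (x,y), (y,x), so the
  degree of a vertex is its \<^const>\<open>out_degree\<close>. For the matrices below the vertex set is
  {0..<N}, so that vertices are directly usable as (0-based) matrix and vector indices.
\<close>

definition adjacency_mat :: "nat \<Rightarrow> nat pair_pre_digraph \<Rightarrow> complex mat" where
  "adjacency_mat N \<Gamma> = mat N N (\<lambda>(i, j). if (i, j) \<in> parcs \<Gamma> then 1 else 0)"

definition degree_mat :: "nat \<Rightarrow> nat pair_pre_digraph \<Rightarrow> complex mat" where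
  "degree_mat N \<Gamma> = mat_diag N (\<lambda>i. of_nat (out_degree (with_proj \<Gamma>) i))"

definition K_mat :: "nat \<Rightarrow> nat pair_pre_digraph \<Rightarrow> complex mat" where
  "K_mat N \<Gamma> = four_block_mat
     (adjacency_mat N \<Gamma>) (degree_mat N \<Gamma> - 1\<^sub>m N)
     (- 1\<^sub>m N)           (0\<^sub>m N N)"

definition jordan_chain :: "complex mat \<Rightarrow> complex \<Rightarrow> complex vec \<Rightarrow> complex vec \<Rightarrow> bool" where
  "jordan_chain K l v u \<longleftrightarrow>
     eigenvector K v l \<and> u \<in> carrier_vec (dim_row K) \<and> K *\<^sub>v u = l \<cdot>\<^sub>v u + v"

definition neighborhood :: "'v pair_pre_digraph \<Rightarrow> 'v \<Rightarrow> 'v set" where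
  "neighborhood \<Gamma> x = {y. (x, y) \<in> parcs \<Gamma>}"

definition regular :: "nat \<Rightarrow> 'v pair_pre_digraph \<Rightarrow> bool" where
  "regular k G \<longleftrightarrow> (\<forall>x\<in>pverts G. out_degree (with_proj G) x = k)"

definition bipartite_with :: "'v pair_pre_digraph \<Rightarrow> 'v set \<Rightarrow> 'v set \<Rightarrow> bool" where
  "bipartite_with G A B \<longleftrightarrow>
     pverts G = A \<union> B \<and> A \<inter> B = {} \<and> parcs G \<subseteq> A \<times> B \<union> B \<times> A"

text \<open>
  The disjoint union of G and H, together with one new edge from each vertex x of G to the
  vertex f x of H.
\<close>
definition attach ::
  "'v pair_pre_digraph \<Rightarrow> 'v pair_pre_digraph \<Rightarrow> ('v \<Rightarrow> 'v) \<Rightarrow> 'v pair_pre_digraph" where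
  "attach G H f = \<lparr> pverts = pverts G \<union> pverts H,
     parcs = parcs G \<union> parcs H \<union> (\<Union>x\<in>pverts G. {(x, f x), (f x, x)}) \<rparr>"

text \<open>
  \<open>in_family n \<Gamma> A B\<close>: the graph \<open>\<Gamma>\<close> belongs to the family \<open>F\<^sub>n\<close>, and A, B are the partite sets
  \<open>{a\<^sub>1,\<dots>,a\<^sub>n}\<close>, \<open>{b\<^sub>1,\<dots>,b\<^sub>n}\<close> of a construction of it. The condition \<open>n \<ge> 1\<close> excludes the empty
  starting graph, which is vacuously 4-regular.
\<close>
definition in_family :: "nat \<Rightarrow> 'v pair_pre_digraph \<Rightarrow> 'v set \<Rightarrow> 'v set \<Rightarrow> bool" where
  "in_family n \<Gamma> A B \<longleftrightarrow> n \<ge> 1 \<and> (\<exists>G H f.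
     pair_graph G \<and> bipartite_with G A B \<and> card A = n \<and> card B = n \<and> regular 4 G \<and>
     pair_graph H \<and> pverts H \<noteq> {} \<and> pverts G \<inter> pverts H = {} \<and>
     f ` pverts G \<subseteq> pverts H \<and> \<Gamma> = attach G H f \<and>
     (\<forall>h\<in>pverts H. card (neighborhood \<Gamma> h \<inter> A) = card (neighborhood \<Gamma> h \<inter> B)) \<and>
     Digraph_Component.connected (with_proj \<Gamma>))"

end

theory Submission
  imports Defs
begin

text \<open>
  The matrix \<open>K\<close> linearizes the quadratic eigenvalue problem of \<open>\<lambda>\<^sup>2 I - \<lambda> A + (D - I)\<close>: for \<open>\<lambda> \<noteq> 0\<close>
  and \<open>s \<noteq> 0\<close>, the vector \<open>s @ (-s/\<lambda>)\<close> is an eigenvector of \<open>K\<close> for \<open>\<lambda>\<close> exactly when \<open>s\<close> is in the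
  kernel of that matrix. If \<open>s\<close> is a
  simultaneous eigenvector of \<open>A\<close> (eigenvalue \<open>\<mu>\<close>) and \<open>D - I\<close> (eigenvalue \<open>d\<close>), this kernel condition
  is the scalar equation \<open>\<lambda>\<^sup>2 - \<mu> \<lambda> + d = 0\<close>. A nontrivial Jordan chain appears when \<open>\<lambda>\<close> is a double
  root, that is, \<open>\<mu> = 2\<lambda>\<close> and \<open>d = \<lambda>\<^sup>2\<close>; this is \<open>jordan_chain_of_common_eigenvector\<close>.

  For a graph of the family take \<open>s\<close> to be \<open>1\<close> on \<open>\<A>\<close>, \<open>-1\<close> on \<open>\<B>\<close> and \<open>0\<close> elsewhere. Each
  vertex of \<open>\<A>\<close> has four neighbours in \<open>\<B>\<close>, none in \<open>\<A>\<close>, and one further neighbour, in the attached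
  graph, where \<open>s\<close> vanishes; hence it has degree five and its neighbours sum to \<open>-4\<close>, and
  symmetrically for \<open>\<B>\<close>. At the other vertices the two sides cancel by the balance condition. So \<open>s\<close>
  has eigenvalue \<open>-4\<close> under \<open>A\<close> and \<open>4\<close> under \<open>D - I\<close>, which is the double root case for \<open>\<lambda> = -2\<close>.
\<close>

section \<open>Jordan chains of the block matrix from double roots\<close>

lemma adjacency_mat_carrier [simp]: "adjacency_mat N \<Gamma> \<in> carrier_mat N N"
  by (simp add: adjacency_mat_def)

lemma degree_mat_carrier [simp]: "degree_mat N \<Gamma> \<in> carrier_mat N N"
  by (simp add: degree_mat_def)

lemma smult_append_vec:
  "k \<cdot>\<^sub>v (v @\<^sub>v w) = (k \<cdot>\<^sub>v v) @\<^sub>v (k \<cdot>\<^sub>v w)"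
  by (intro eq_vecI) auto

lemma K_mat_mult_append:
  assumes "v \<in> carrier_vec N" "w \<in> carrier_vec N"
  shows "K_mat N \<Gamma> *\<^sub>v (v @\<^sub>v w) =
    (adjacency_mat N \<Gamma> *\<^sub>v v + (degree_mat N \<Gamma> - 1\<^sub>m N) *\<^sub>v w) @\<^sub>v (- v)"
proof -
  have "K_mat N \<Gamma> *\<^sub>v (v @\<^sub>v w) =
    (adjacency_mat N \<Gamma> *\<^sub>v v + (degree_mat N \<Gamma> - 1\<^sub>m N) *\<^sub>v w) @\<^sub>v (- 1\<^sub>m N *\<^sub>v v + 0\<^sub>m N N *\<^sub>v w)"
    unfolding K_mat_def using assms
    by (intro four_block_mat_mult_vec[OF adjacency_mat_carrier]) auto
  also have "- 1\<^sub>m N *\<^sub>v v + 0\<^sub>m N N *\<^sub>v w = - v"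
    using assms by auto
  finally show ?thesis .
qed

text \<open>
  With \<open>\<mu> = 2l\<close> and \<open>d = l\<^sup>2\<close> the eigenvalues of \<open>s\<close> under \<open>A\<close> and \<open>D - I\<close>, the polynomial \<open>x\<^sup>2 - \<mu> x + d\<close> is \<open>(x - l)\<^sup>2\<close>. Vanishing of the polynomial
  at \<open>l\<close> gives the eigenvector equation; vanishing of its derivative gives the equation for the
  generalized eigenvector.
\<close>
lemma jordan_chain_of_common_eigenvector:
  assumes s: "s \<in> carrier_vec N" "s \<noteq> 0\<^sub>v N"
    and A: "adjacency_mat N \<Gamma> *\<^sub>v s = (2 * l) \<cdot>\<^sub>v s"
    and D: "(degree_mat N \<Gamma> - 1\<^sub>m N) *\<^sub>v s = (l ^ 2) \<cdot>\<^sub>v s"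
    and l: "l \<noteq> 0"
  shows "jordan_chain (K_mat N \<Gamma>) l (s @\<^sub>v ((- (1 / l)) \<cdot>\<^sub>v s)) (((1 / l) \<cdot>\<^sub>v s) @\<^sub>v 0\<^sub>v N)"
proof -
  let ?v = "s @\<^sub>v ((- (1 / l)) \<cdot>\<^sub>v s)" and ?u = "((1 / l) \<cdot>\<^sub>v s) @\<^sub>v 0\<^sub>v N"
  have dim: "dim_row (K_mat N \<Gamma>) = N + N"
    by (simp add: K_mat_def adjacency_mat_def)
  have dim_s: "dim_vec s = N"
    using s by simp
  have "0\<^sub>v (N + N) = 0\<^sub>v N @\<^sub>v (0\<^sub>v N :: complex vec)"
    by (intro eq_vecI) auto
  then have nonzero: "?v \<noteq> 0\<^sub>v (N + N)"
    using s append_vec_eq[of s N "0\<^sub>v N"] by simp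
  have Dmat: "degree_mat N \<Gamma> - 1\<^sub>m N \<in> carrier_mat N N"
    by (simp add: minus_carrier_mat)
  have "K_mat N \<Gamma> *\<^sub>v ?v =
      ((2 * l) \<cdot>\<^sub>v s + (- (1 / l)) \<cdot>\<^sub>v ((l ^ 2) \<cdot>\<^sub>v s)) @\<^sub>v (- s)"
    using s by (simp add: K_mat_mult_append A mult_mat_vec[OF Dmat] D)
  also have "\<dots> = l \<cdot>\<^sub>v ?v"
    using l dim_s by (intro eq_vecI) (auto simp: power2_eq_square)
  finally have eigen: "K_mat N \<Gamma> *\<^sub>v ?v = l \<cdot>\<^sub>v ?v" .
  have D0: "(degree_mat N \<Gamma> - 1\<^sub>m N) *\<^sub>v 0\<^sub>v N = 0\<^sub>v N"
    using Dmat by (intro eq_vecI) auto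
  have "K_mat N \<Gamma> *\<^sub>v ?u = ((1 / l) \<cdot>\<^sub>v ((2 * l) \<cdot>\<^sub>v s) + 0\<^sub>v N) @\<^sub>v (- ((1 / l) \<cdot>\<^sub>v s))"
    using s by (simp add: K_mat_mult_append mult_mat_vec[OF adjacency_mat_carrier] A D0)
  also have "\<dots> = l \<cdot>\<^sub>v ?u + ?v"
    using l dim_s by (intro eq_vecI) auto
  finally have chain: "K_mat N \<Gamma> *\<^sub>v ?u = l \<cdot>\<^sub>v ?u + ?v" .
  show ?thesis
    unfolding jordan_chain_def eigenvector_def dim using s nonzero eigen chain by auto
qed

section \<open>Adjacency and degree as neighbourhood counts\<close>

lemma adjacency_mat_mult_vec:
  assumes "\<And>i. i < N \<Longrightarrow> neighborhood \<Gamma> i \<subseteq> {0..<N}"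
  shows "adjacency_mat N \<Gamma> *\<^sub>v vec N s = vec N (\<lambda>i. \<Sum>j\<in>neighborhood \<Gamma> i. s j)"
proof (intro eq_vecI)
  fix i assume "i < dim_vec (vec N (\<lambda>i. \<Sum>j\<in>neighborhood \<Gamma> i. s j))"
  then have i: "i < N" by simp
  then have "(adjacency_mat N \<Gamma> *\<^sub>v vec N s) $ i
      = (\<Sum>j\<in>{0..<N}. if j \<in> neighborhood \<Gamma> i then s j else 0)"
    by (auto simp: adjacency_mat_def scalar_prod_def neighborhood_def intro!: sum.cong)
  also have "\<dots> = (\<Sum>j\<in>neighborhood \<Gamma> i. s j)"
    using assms[OF i] by (intro sum.mono_neutral_cong_right) auto
  finally show "(adjacency_mat N \<Gamma> *\<^sub>v vec N s) $ i = vec N (\<lambda>i. \<Sum>j\<in>neighborhood \<Gamma> i. s j) $ i"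
    using i by simp
qed (simp add: adjacency_mat_def)

lemma mat_diag_mult_vec:
  "mat_diag N f *\<^sub>v vec N (s :: nat \<Rightarrow> complex) = vec N (\<lambda>i. f i * s i)"
proof (intro eq_vecI)
  fix i assume "i < dim_vec (vec N (\<lambda>i. f i * s i))"
  then have i: "i < N" by simp
  then have "(mat_diag N f *\<^sub>v vec N s) $ i = (\<Sum>j\<in>{0..<N}. (if i = j then f j else 0) * s j)"
    by (simp add: mat_diag_def scalar_prod_def)
  also have "\<dots> = (\<Sum>j\<in>{0..<N}. if i = j then f j * s j else 0)"
    by (intro sum.cong) auto
  finally show "(mat_diag N f *\<^sub>v vec N s) $ i = vec N (\<lambda>i. f i * s i) $ i"
    using i by simp
qed (simp add: mat_diag_def)

lemma degree_mat_minus_one_mult_vec: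
  "(degree_mat N \<Gamma> - 1\<^sub>m N) *\<^sub>v vec N s
    = vec N (\<lambda>i. (of_nat (out_degree (with_proj \<Gamma>) i) - 1) * s i)"
proof -
  have "(degree_mat N \<Gamma> - 1\<^sub>m N) *\<^sub>v vec N s = degree_mat N \<Gamma> *\<^sub>v vec N s - 1\<^sub>m N *\<^sub>v vec N s"
    by (rule minus_mult_distrib_mat_vec) auto
  then show ?thesis
    by (auto simp: degree_mat_def mat_diag_mult_vec algebra_simps)
qed

lemma out_degree_eq_card_neighborhood:
  "out_degree (with_proj \<Gamma>) x = card (neighborhood \<Gamma> x)"
proof -
  have "out_arcs (with_proj \<Gamma>) x = Pair x ` neighborhood \<Gamma> x"
    by (auto simp: out_arcs_def neighborhood_def)
  then show ?thesis
    by (simp add: out_degree_def card_image inj_on_def)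
qed

lemma sum_sign_eq_card_diff:
  assumes "finite S" "A \<inter> B = {}"
  shows "(\<Sum>x\<in>S. if x \<in> A then 1 else if x \<in> B then - 1 else 0)
    = (of_nat (card (S \<inter> A)) - of_nat (card (S \<inter> B)) :: complex)"
proof -
  have "(\<Sum>x\<in>S. if x \<in> A then 1 else if x \<in> B then - 1 else 0)
      = (\<Sum>x\<in>S. (if x \<in> A then 1 else 0) - (if x \<in> B then 1 else 0 :: complex))"
    using assms(2) by (intro sum.cong) auto
  also have "\<dots> = of_nat (card (S \<inter> A)) - of_nat (card (S \<inter> B))"
    using assms(1) by (simp add: sum_subtractf flip: sum.inter_restrict)
  finally show ?thesis .
qed

section \<open>Neighbourhoods in graphs of the family\<close>

lemma in_family_swap: "in_family n \<Gamma> A B \<Longrightarrow> in_family n \<Gamma> B A"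
  unfolding in_family_def bipartite_with_def by (metis Int_commute Un_commute)

lemma neighborhood_subset_pverts:
  assumes "in_family n \<Gamma> A B"
  shows "neighborhood \<Gamma> x \<subseteq> pverts \<Gamma>"
proof -
  obtain G H f where G: "pair_graph G" and H: "pair_graph H"
    and f: "f ` pverts G \<subseteq> pverts H" and \<Gamma>: "\<Gamma> = attach G H f"
    using assms unfolding in_family_def by blast
  interpret G: pair_graph G by fact
  interpret H: pair_graph H by fact
  show ?thesis
    unfolding \<Gamma> using f G.arc_snd_in_verts H.arc_snd_in_verts by (fastforce simp: neighborhood_def attach_def)
qed

lemma in_family_partite_sets:
  assumes "in_family n \<Gamma> A B"
  shows "A \<noteq> {}" "A \<inter> B = {}" "A \<union> B \<subseteq> pverts \<Gamma>"
  using assms unfolding in_family_def bipartite_with_def by (auto simp: attach_def)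

text \<open>
  Attaching leaves the arcs of \<open>G\<close> at a vertex \<open>x\<close> of \<open>G\<close> intact and adds one neighbour, which is new
  because it is a vertex of \<open>H\<close>.
\<close>
lemma neighborhood_partite_set:
  assumes "in_family n \<Gamma> A B" and x: "x \<in> A"
  shows "neighborhood \<Gamma> x \<inter> A = {}"
    and "card (neighborhood \<Gamma> x \<inter> B) = 4"
    and "card (neighborhood \<Gamma> x) = 5"
proof -
  obtain G H f where G: "pair_graph G" "bipartite_with G A B" "regular 4 G"
    and H: "pair_graph H" "pverts G \<inter> pverts H = {}"
    and f: "f ` pverts G \<subseteq> pverts H" and \<Gamma>: "\<Gamma> = attach G H f"
    using assms unfolding in_family_def by blast
  interpret G: pair_graph G by fact
  interpret H: pair_graph H by fact
  have xG: "x \<in> pverts G" and verts: "pverts G = A \<union> B" and disj: "A \<inter> B = {}"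
    and arcs: "parcs G \<subseteq> A \<times> B \<union> B \<times> A"
    using G x by (auto simp: bipartite_with_def)
  have "x \<notin> pverts H"
    using xG H by blast
  then have "(x, y) \<notin> parcs H" for y
    using H.arc_fst_in_verts by fastforce
  moreover have "x \<noteq> f y" if "y \<in> pverts G" for y
    using that f \<open>x \<notin> pverts H\<close> by blast
  ultimately have nb: "neighborhood \<Gamma> x = insert (f x) (neighborhood G x)"
    using xG unfolding \<Gamma> by (auto simp: neighborhood_def attach_def)
  have sub: "neighborhood G x \<subseteq> B"
    using arcs x disj by (auto simp: neighborhood_def)
  have fx: "f x \<notin> A \<union> B"
    using f xG H verts by blast
  have card4: "card (neighborhood G x) = 4"
    using G(3) xG by (simp add: regular_def out_degree_eq_card_neighborhood)
  show "neighborhood \<Gamma> x \<inter> A = {}"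
    using nb sub fx disj by auto
  have "neighborhood \<Gamma> x \<inter> B = neighborhood G x"
    using nb sub fx by auto
  then show "card (neighborhood \<Gamma> x \<inter> B) = 4"
    using card4 by simp
  have "finite (neighborhood G x)"
    using card4 by (metis card.infinite zero_neq_numeral)
  moreover have "f x \<notin> neighborhood G x"
    using sub fx by auto
  ultimately show "card (neighborhood \<Gamma> x) = 5"
    using nb card4 by simp
qed

lemma neighborhood_balanced:
  assumes "in_family n \<Gamma> A B" "x \<in> pverts \<Gamma>" "x \<notin> A" "x \<notin> B"
  shows "card (neighborhood \<Gamma> x \<inter> A) = card (neighborhood \<Gamma> x \<inter> B)"
  using assms unfolding in_family_def bipartite_with_def by (auto simp: attach_def)

section \<open>The sign vector of the two partite sets\<close>

theorem proposition4p3: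
  fixes \<Gamma> :: "nat pair_pre_digraph" and n n' :: nat and A B :: "nat set"
  assumes "in_family n \<Gamma> A B"
    and "pverts \<Gamma> = {0..<n'}"
  shows "jordan_chain (K_mat n' \<Gamma>) (-2)
    (vec n' (\<lambda>j. if j \<in> A then 1 else if j \<in> B then -1 else 0) @\<^sub>v
     vec n' (\<lambda>j. if j \<in> A then 1/2 else if j \<in> B then -1/2 else 0))
    (vec n' (\<lambda>j. if j \<in> A then -1/2 else if j \<in> B then 1/2 else 0) @\<^sub>v
     vec n' (\<lambda>j. 0))"
proof -
  define s :: "nat \<Rightarrow> complex" where "s = (\<lambda>j. if j \<in> A then 1 else if j \<in> B then - 1 else 0)"
  note partite = in_family_partite_sets[OF assms(1)]
  note at_A = neighborhood_partite_set[OF assms(1)]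
  note at_B = neighborhood_partite_set[OF in_family_swap[OF assms(1)]]
  have sub: "neighborhood \<Gamma> i \<subseteq> {0..<n'}" for i
    using neighborhood_subset_pverts[OF assms(1)] assms(2) by simp
  then have "finite (neighborhood \<Gamma> i)" for i
    using finite_subset by blast
  then have sum_s: "(\<Sum>j\<in>neighborhood \<Gamma> i. s j)
      = of_nat (card (neighborhood \<Gamma> i \<inter> A)) - of_nat (card (neighborhood \<Gamma> i \<inter> B))" for i
    unfolding s_def using partite(2) by (intro sum_sign_eq_card_diff)
  have adj: "(\<Sum>j\<in>neighborhood \<Gamma> i. s j) = - 4 * s i" if "i < n'" for i
  proof -
    consider "i \<in> A" | "i \<in> B" "i \<notin> A" | "i \<notin> A" "i \<notin> B" by blast
    then show ?thesis
    proof cases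
      case 1
      then show ?thesis unfolding sum_s by (simp add: at_A s_def)
    next
      case 2
      then show ?thesis unfolding sum_s by (simp add: at_B s_def)
    next
      case 3
      then show ?thesis
        unfolding sum_s using neighborhood_balanced[OF assms(1)] assms(2) that by (simp add: s_def)
    qed
  qed
  have deg: "(of_nat (out_degree (with_proj \<Gamma>) i) - 1) * s i = 4 * s i" for i
    by (simp add: s_def out_degree_eq_card_neighborhood at_A at_B)
  obtain a where "a \<in> A" "a < n'"
    using partite assms(2) by fastforce
  then have "vec n' s $ a \<noteq> 0\<^sub>v n' $ a"
    by (simp add: s_def)
  then have "vec n' s \<noteq> 0\<^sub>v n'"
    by metis
  moreover have "adjacency_mat n' \<Gamma> *\<^sub>v vec n' s = (2 * (- 2)) \<cdot>\<^sub>v vec n' s"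
    unfolding adjacency_mat_mult_vec[OF sub] by (intro eq_vecI) (simp_all add: adj)
  moreover have "(degree_mat n' \<Gamma> - 1\<^sub>m n') *\<^sub>v vec n' s = ((- 2) ^ 2) \<cdot>\<^sub>v vec n' s"
    unfolding degree_mat_minus_one_mult_vec deg by (intro eq_vecI) simp_all
  ultimately have "jordan_chain (K_mat n' \<Gamma>) (- 2)
      (vec n' s @\<^sub>v ((- (1 / (- 2))) \<cdot>\<^sub>v vec n' s)) (((1 / (- 2)) \<cdot>\<^sub>v vec n' s) @\<^sub>v 0\<^sub>v n')"
    by (intro jordan_chain_of_common_eigenvector) auto
  also have "(- (1 / (- 2))) \<cdot>\<^sub>v vec n' s = vec n' (\<lambda>j. if j \<in> A then 1/2 else if j \<in> B then -1/2 else 0)"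
    by (intro eq_vecI) (auto simp: s_def)
  also have "(1 / (- 2)) \<cdot>\<^sub>v vec n' s = vec n' (\<lambda>j. if j \<in> A then -1/2 else if j \<in> B then 1/2 else 0)"
    by (intro eq_vecI) (auto simp: s_def)
  also have "0\<^sub>v n' = vec n' (\<lambda>j. 0 :: complex)"
    by (simp add: zero_vec_def)
  finally show ?thesis
    by (simp add: s_def)
qed

end
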